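(* Let $\phi_\lambda$ be a (possibly non-convex) regularizer with proximal operator $h$ (applied entrywise to vectors). Let $W\in\mathbb{R}^{d\times N}$ satisfy $\frac1N WW^\top=I_d$, let $x\in\mathbb{R}^d$, let $y_0\in\mathbb{R}^N$, and define for $t\ge0$ $$y_{t+1}=h\Big(W^\top x+\big(I_N-\tfrac1N W^\top W\big)y_t\Big).$$ Let $\widehat Q(y)=\frac12\|x-\frac1N Wy\|_2^2+\frac1N\phi_\lambda(y)$ for $y\in\mathbb{R}^N$. Then for all $t\ge0$, $$\begin{aligned}\widehat Q(y_{t+1})&\le\widehat Q(y_t)-\tfrac1{2N}\|y_{t+1}-y_t\|_2^2+\tfrac12\big\|\tfrac1N W(y_{t+1}-y_t)\big\|_2^2\\&=\widehat Q(y_t)-\tfrac1{2N}\big\|\big(I_N-\tfrac1N W^\top W\big)(y_{t+1}-y_t)\big\|_2^2\le\widehat Q(y_t).\end{aligned}$$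
   Context: The regularizer is a function $\phi_\lambda:\mathbb{R}\to(-\infty,+\infty]$ (depending on a parameter $\lambda$), bounded from below and not identically $+\infty$; for a vector $y\in\mathbb{R}^N$, $\phi_\lambda(y):=\sum_{i=1}^N\phi_\lambda(y_i)$. Its proximal operator is $h(z)=\arg\min_{u\in\mathbb{R}}\{\frac12(u-z)^2+\phi_\lambda(u)\}$, where a minimizer is assumed to exist for every $z\in\mathbb{R}$ and $h(z)$ denotes a chosen minimizer; $h$ acts entrywise on vectors. *)

theory Defs
  imports "HOL-Analysis.Analysis"
begin

text \<open>Regularizers take values in \<open>(-\<infinity>, +\<infinity>]\<close>; indicator-type penalties, with
  value \<open>+\<infinity>\<close>, and non-convex ones are allowed.\<close>

definition regularizer :: "(real \<Rightarrow> ereal) \<Rightarrow> bool" where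
  "regularizer \<phi> \<longleftrightarrow>
     (\<forall>u. \<phi> u \<noteq> -\<infinity>) \<and> (\<exists>m::real. \<forall>u. ereal m \<le> \<phi> u) \<and> (\<exists>u. \<phi> u \<noteq> \<infinity>)"

definition vec_reg :: "(real \<Rightarrow> ereal) \<Rightarrow> real ^ 'n \<Rightarrow> ereal" where
  "vec_reg \<phi> y = (\<Sum>i\<in>UNIV. \<phi> (y $ i))"

text \<open>Without convexity the minimizer need not be unique, so the operator is a selection
  \<open>h\<close> of minimizers rather than a function determined by \<open>\<phi>\<close>.\<close>

definition is_proximal_operator :: "(real \<Rightarrow> ereal) \<Rightarrow> (real \<Rightarrow> real) \<Rightarrow> bool" where
  "is_proximal_operator \<phi> h \<longleftrightarrow>
     (\<forall>z. is_arg_min (\<lambda>u. ereal (1/2 * (u - z)\<^sup>2) + \<phi> u) (\<lambda>u. True) (h z))"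

definition entrywise :: "(real \<Rightarrow> real) \<Rightarrow> real ^ 'n \<Rightarrow> real ^ 'n" where
  "entrywise h v = (\<chi> i. h (v $ i))"

definition Q_hat ::
  "(real \<Rightarrow> ereal) \<Rightarrow> real ^ 'n ^ 'd \<Rightarrow> real ^ 'd \<Rightarrow> real ^ 'n \<Rightarrow> ereal" where
  "Q_hat \<phi> W x y =
     ereal (1/2 * (norm (x - (1 / real CARD('n)) *\<^sub>R (W *v y)))\<^sup>2)
     + ereal (1 / real CARD('n)) * vec_reg \<phi> y"

end

theory Submission
  imports Defs
begin

text \<open>The argument of \<open>h\<close> is \<open>y t + transpose W *v r\<close> with residual \<open>r = x - W y t / N\<close>. Comparing
  the proximal objective at its minimizer \<open>y (t + 1)\<close> with its value at \<open>y t\<close>, summed over the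
  entries and divided by \<open>N\<close>, cancels the cross term in the expansion of the quadratic part of
  \<open>Q_hat\<close>, which gives the first inequality. The equality holds because \<open>W W\<^sup>T = N I\<close> makes
  \<open>I - W\<^sup>T W / N\<close> an orthogonal projection.\<close>

lemma is_proximal_operator_le:
  assumes "is_proximal_operator \<phi> h"
  shows "ereal (1/2 * (h z - z)\<^sup>2) + \<phi> (h z) \<le> ereal (1/2 * (u - z)\<^sup>2) + \<phi> u"
  using assms by (auto simp: is_proximal_operator_def is_arg_min_def not_less)

text \<open>Squared norm and \<open>vec_reg\<close> both split over coordinates, so scalar
  minimality at each entry can be summed.\<close>

lemma vec_reg_entrywise_le:
  fixes a z :: "real ^ 'n"
  assumes "is_proximal_operator \<phi> h"
  shows "ereal (1/2 * (norm (entrywise h z - z))\<^sup>2) + vec_reg \<phi> (entrywise h z)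
           \<le> ereal (1/2 * (norm (a - z))\<^sup>2) + vec_reg \<phi> a"
proof -
  have norm_sum: "ereal (1/2 * (norm v)\<^sup>2) = (\<Sum>i\<in>UNIV. ereal (1/2 * (v $ i)\<^sup>2))" for v :: "real ^ 'n"
    unfolding sum_ereal
    by (simp add: norm_vec_def L2_set_def sum_nonneg sum_distrib_left sum_divide_distrib)
  show ?thesis
    unfolding norm_sum vec_reg_def sum.distrib[symmetric]
    by (intro sum_mono) (use is_proximal_operator_le[OF assms] in \<open>simp add: entrywise_def\<close>)
qed

text \<open>Leaves only finite values and +\<infinity> to treat when extended-real inequalities are
  reduced to real ones.\<close>

lemma vec_reg_neq_minus_infinity:
  fixes y :: "real ^ 'n"
  assumes "regularizer \<phi>"
  shows "vec_reg \<phi> y \<noteq> -\<infinity>"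
proof -
  obtain m where m: "\<And>u. ereal m \<le> \<phi> u"
    using assms by (auto simp: regularizer_def)
  have "ereal (\<Sum>i\<in>(UNIV :: 'n set). m) \<le> vec_reg \<phi> y"
    unfolding vec_reg_def sum_ereal[symmetric] by (intro sum_mono m)
  then show ?thesis by auto
qed

lemma inner_matrix_vector_transpose:
  fixes W :: "real ^ 'n ^ 'd"
  shows "u \<bullet> (transpose W *v v) = (W *v u) \<bullet> v"
  by (metis dot_lmul_matrix inner_commute transpose_matrix_vector)

text \<open>With \<open>w = W *v e\<close> and \<open>v = transpose W *v w\<close>, both
  \<open>e \<bullet> v\<close> and \<open>c * (v \<bullet> v)\<close> equal
  \<open>w \<bullet> w\<close>, so the last two terms of |e|^2 - 2c (e \<bullet> v) + c^2 (v
  \<bullet> v) merge.\<close>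

lemma norm_sq_kernel_projection:
  fixes W :: "real ^ 'n ^ 'd" and e :: "real ^ 'n"
  assumes "c *\<^sub>R (W ** transpose W) = mat 1"
  shows "(norm ((mat 1 - c *\<^sub>R (transpose W ** W)) *v e))\<^sup>2 = (norm e)\<^sup>2 - c * (norm (W *v e))\<^sup>2"
proof -
  define w where "w = W *v e"
  define v where "v = transpose W *v w"
  have P: "(mat 1 - c *\<^sub>R (transpose W ** W)) *v e = e - c *\<^sub>R v"
    by (simp add: v_def w_def matrix_vector_mult_diff_rdistrib scaleR_matrix_vector_assoc[symmetric]
        matrix_vector_mul_assoc)
  have ev: "e \<bullet> v = w \<bullet> w"
    unfolding v_def inner_matrix_vector_transpose w_def ..
  have "c *\<^sub>R (W *v v) = w"
    using arg_cong[OF assms, of "\<lambda>A. A *v w"]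
    by (simp only: v_def scaleR_matrix_vector_assoc[symmetric] matrix_vector_mul_assoc[symmetric]
        matrix_vector_mul_lid)
  moreover have "v \<bullet> v = (W *v v) \<bullet> w"
    by (metis v_def inner_matrix_vector_transpose)
  ultimately have "c * (v \<bullet> v) = w \<bullet> w"
    by (metis inner_scaleR_left)
  then show ?thesis
    unfolding P w_def[symmetric] power2_norm_eq_inner
    by (simp add: inner_diff_left inner_diff_right inner_commute[of v e] ev)
qed

lemma Q_hat_entrywise_le:
  fixes W :: "real ^ 'n ^ 'd" and x :: "real ^ 'd" and a :: "real ^ 'n"
  assumes reg: "regularizer \<phi>" and prox: "is_proximal_operator \<phi> h"
    and b: "b = entrywise h (transpose W *v x
           + (mat 1 - (1 / real CARD('n)) *\<^sub>R (transpose W ** W)) *v a)"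
  shows "Q_hat \<phi> W x b
           \<le> Q_hat \<phi> W x a - ereal (1 / (2 * real CARD('n)) * (norm (b - a))\<^sup>2)
             + ereal (1/2 * (norm ((1 / real CARD('n)) *\<^sub>R (W *v (b - a))))\<^sup>2)"
proof -
  define c where "c = 1 / real CARD('n)"
  have c: "c > 0" by (simp add: c_def)
  define r where "r = x - c *\<^sub>R (W *v a)"
  define g where "g = transpose W *v r"
  have "transpose W *v x + (mat 1 - c *\<^sub>R (transpose W ** W)) *v a = a + g"
    by (simp add: g_def r_def matrix_vector_mult_diff_rdistrib matrix_vector_mult_diff_distrib
        scaleR_matrix_vector_assoc[symmetric] matrix_vector_mul_assoc matrix_vector_mult_scaleR)
  then have le: "ereal (1/2 * (norm (b - (a + g)))\<^sup>2) + vec_reg \<phi> b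
      \<le> ereal (1/2 * (norm (a - (a + g)))\<^sup>2) + vec_reg \<phi> a"
    using vec_reg_entrywise_le[OF prox, of "a + g" a] by (simp add: b c_def)
  show ?thesis
  proof (cases "vec_reg \<phi> a")
    \<comment> \<open>The right-hand side is then +\<infinity>: its other terms are finite.\<close>
    case PInf
    then show ?thesis
      by (simp add: Q_hat_def)
  next
    case MInf
    then show ?thesis
      using vec_reg_neq_minus_infinity[OF reg] by blast
  next
    case (real A)
    \<comment> \<open>Finiteness at \<open>a\<close> passes to \<open>b\<close> through
      \<open>le\<close>; from here on the argument is over the reals.\<close>
    then obtain B where B: "vec_reg \<phi> b = ereal B"
      using le vec_reg_neq_minus_infinity[OF reg, of b] by (cases "vec_reg \<phi> b") auto
    have "1/2 * (norm ((b - a) - g))\<^sup>2 + B \<le> 1/2 * (norm g)\<^sup>2 + A"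
      using le by (simp add: real B algebra_simps)
    \<comment> \<open>Polarization of the left square; the two copies of |g|^2/2 cancel.\<close>
    then have "B \<le> A - 1/2 * (norm (b - a))\<^sup>2 + (b - a) \<bullet> g"
      using dot_norm_neg[of "b - a" g] by (simp add: field_simps)
    then have cB: "c * B \<le> c * (A - 1/2 * (norm (b - a))\<^sup>2 + (b - a) \<bullet> g)"
      using c by simp
    \<comment> \<open>Identifies the proximal cross term with the one from expanding the new
      residual, where it enters with factor \<open>- c\<close>.\<close>
    have cross: "(b - a) \<bullet> g = r \<bullet> (W *v (b - a))"
      unfolding g_def inner_matrix_vector_transpose by (rule inner_commute)
    have "x - c *\<^sub>R (W *v b) = r - c *\<^sub>R (W *v (b - a))"
      by (simp add: r_def matrix_vector_mult_diff_distrib algebra_simps)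
    then have "1/2 * (norm (x - c *\<^sub>R (W *v b)))\<^sup>2
        = 1/2 * (norm r)\<^sup>2 - c * ((b - a) \<bullet> g) + 1/2 * (norm (c *\<^sub>R (W *v (b - a))))\<^sup>2"
      using dot_norm_neg[of r "c *\<^sub>R (W *v (b - a))"] unfolding cross by simp
    with cB have "1/2 * (norm (x - c *\<^sub>R (W *v b)))\<^sup>2 + c * B
        \<le> 1/2 * (norm r)\<^sup>2 + c * A - c/2 * (norm (b - a))\<^sup>2
          + 1/2 * (norm (c *\<^sub>R (W *v (b - a))))\<^sup>2"
      by (simp add: algebra_simps)
    then show ?thesis
      by (simp add: Q_hat_def real B c_def r_def)
  qed
qed

theorem theorem3:
  fixes \<phi> :: "real \<Rightarrow> ereal" and h :: "real \<Rightarrow> real"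
    and W :: "real ^ 'n ^ 'd" and x :: "real ^ 'd"
    and y0 :: "real ^ 'n" and y :: "nat \<Rightarrow> real ^ 'n" and t :: nat
  assumes "regularizer \<phi>"
    and "is_proximal_operator \<phi> h"
    and "(1 / real CARD('n)) *\<^sub>R (W ** transpose W) = mat 1"
    and "y 0 = y0"
    and "\<And>s. y (Suc s) = entrywise h (transpose W *v x
           + (mat 1 - (1 / real CARD('n)) *\<^sub>R (transpose W ** W)) *v y s)"
  shows "Q_hat \<phi> W x (y (Suc t))
           \<le> Q_hat \<phi> W x (y t)
             - ereal (1 / (2 * real CARD('n)) * (norm (y (Suc t) - y t))\<^sup>2)
             + ereal (1/2 * (norm ((1 / real CARD('n)) *\<^sub>R (W *v (y (Suc t) - y t))))\<^sup>2)
       \<and> Q_hat \<phi> W x (y t)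
             - ereal (1 / (2 * real CARD('n)) * (norm (y (Suc t) - y t))\<^sup>2)
             + ereal (1/2 * (norm ((1 / real CARD('n)) *\<^sub>R (W *v (y (Suc t) - y t))))\<^sup>2)
           = Q_hat \<phi> W x (y t)
             - ereal (1 / (2 * real CARD('n)) * (norm
                 ((mat 1 - (1 / real CARD('n)) *\<^sub>R (transpose W ** W)) *v (y (Suc t) - y t)))\<^sup>2)
       \<and> Q_hat \<phi> W x (y t)
             - ereal (1 / (2 * real CARD('n)) * (norm
                 ((mat 1 - (1 / real CARD('n)) *\<^sub>R (transpose W ** W)) *v (y (Suc t) - y t)))\<^sup>2)
           \<le> Q_hat \<phi> W x (y t)"
proof -
  let ?e = "y (Suc t) - y t" and ?P = "mat 1 - (1 / real CARD('n)) *\<^sub>R (transpose W ** W)"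
  \<comment> \<open>With c = 1/N, the factor 1/(2N) turns c |We|^2 into |c We|^2 / 2.\<close>
  have "1 / (2 * real CARD('n)) * (norm (?P *v ?e))\<^sup>2
      = 1 / (2 * real CARD('n)) * (norm ?e)\<^sup>2 - 1/2 * (norm ((1 / real CARD('n)) *\<^sub>R (W *v ?e)))\<^sup>2"
    unfolding norm_sq_kernel_projection[OF assms(3)]
    by (simp add: power_divide right_diff_distrib power2_eq_square)
  \<comment> \<open>Stated for every extended real \<open>q\<close> because \<open>Q_hat\<close> at
    \<open>y t\<close> may be +\<infinity>, for instance at the arbitrary start
    \<open>y0\<close>.\<close>
  then have "q - ereal (1 / (2 * real CARD('n)) * (norm ?e)\<^sup>2)
        + ereal (1/2 * (norm ((1 / real CARD('n)) *\<^sub>R (W *v ?e)))\<^sup>2)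
      = q - ereal (1 / (2 * real CARD('n)) * (norm (?P *v ?e))\<^sup>2)" for q
    by (cases q) auto
  moreover have "q - ereal (1 / (2 * real CARD('n)) * (norm (?P *v ?e))\<^sup>2) \<le> q" for q
    by (cases q) auto
  ultimately show ?thesis
    using Q_hat_entrywise_le[OF assms(1,2) assms(5)[of t]] by blast
qed

end
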